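(* For every real $\lambda\geq 1$ and every integer $n\geq 0$, the ultraspherical polynomial $P_n^{(\lambda)}$ satisfies $$P_n^{(\lambda)}(1)-P_n^{(\lambda)}(x)\geq (1-x)\,\frac{d}{dx}\bigl\{P_n^{(\lambda)}(x)\bigr\}\qquad\text{for all } x\in[0,1].$$
   Context: For $\lambda>0$, $P_n^{(\lambda)}$ denotes the ultraspherical (Gegenbauer) polynomial of degree $n$ in the standard normalization, given by the generating function $(1-2xt+t^2)^{-\lambda}=\sum_{n\ge0}P_n^{(\lambda)}(x)\,t^n$; it is orthogonal on $[-1,1]$ with respect to the weight $(1-x^2)^{\lambda-1/2}$. In this normalization $T_n'=n\,P_{n-1}^{(1)}$ for $n\ge 1$, where $T_n$ is the Chebyshev polynomial of the first kind. *)

theory Defs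
  imports "HOL-Analysis.Analysis" "HOL-Computational_Algebra.Computational_Algebra"
begin

text \<open>
  The generating function \<open>(1 - 2 x t + t\<^sup>2)\<^bsup>-lam\<^esup>\<close>, read as a formal power series in \<open>t\<close> whose
  coefficients are real polynomials in \<open>x\<close> (the polynomial \<open>[:0, 2:]\<close> is \<open>2 x\<close>): the binomial series
  \<open>(1 + u)\<^bsup>-lam\<^esup>\<close> composed with \<open>u = t\<^sup>2 - 2 x t\<close>. The library's \<open>fps_binomial\<close> requires a field of
  coefficients, so the binomial series is written out here; \<open>ultraspherical_gf_at\<close> below gives the
  connection at each fixed real \<open>x\<close>.
\<close>
definition ultraspherical_gf :: "real \<Rightarrow> real poly fps" where
  "ultraspherical_gf lam =
     fps_compose (Abs_fps (\<lambda>k. [:(-lam) gchoose k:])) (fps_X ^ 2 - fps_const [:0, 2:] * fps_X)"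

definition ultraspherical :: "real \<Rightarrow> nat \<Rightarrow> real poly" where
  "ultraspherical lam n = fps_nth (ultraspherical_gf lam) n"

lemma poly_fps_nth_power:
  fixes F :: "real poly fps"
  shows "poly (fps_nth (F ^ i) n) x = fps_nth (Abs_fps (\<lambda>k. poly (fps_nth F k) x) ^ i) n"
  by (induction i arbitrary: n) (simp_all add: fps_mult_nth poly_sum)

lemma ultraspherical_gf_at:
  "Abs_fps (\<lambda>n. poly (ultraspherical lam n) x) =
     fps_compose (fps_binomial (-lam)) (fps_X ^ 2 - fps_const (2 * x) * fps_X)"
proof -
  have "Abs_fps (\<lambda>k. poly (fps_nth (fps_X ^ 2 - fps_const [:0, 2:] * fps_X) k) x) =
          fps_X ^ 2 - fps_const (2 * x) * fps_X"
    by (rule fps_ext) (simp add: fps_X_power_nth)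
  thus ?thesis
    by (intro fps_ext)
       (simp add: ultraspherical_def ultraspherical_gf_def fps_compose_nth poly_sum
          poly_fps_nth_power)
qed

end

(* For l >= 1 the polynomial P_n^(l) is a nonnegative combination of Chebyshev polynomials U_m
   of the second kind: the coefficients a_k a_(n-k), a_k = (l)_k / k!, of the cosine expansion of
   P_n^(l)(cos t) are symmetric and unimodal, and summation by parts turns cosines into U_m's with
   the increments as coefficients. The inequality is linear in the polynomial, so it suffices to
   treat U_(n-1), where with x = cos t it reads
     n sin t (1 + cos t + cos nt) >= (1 + 2 cos t) sin nt      (0 < t <= pi/2).
   Most of the range follows from sin^2 nt + cos^2 nt = 1 alone. The remaining cases are nt <= pi with
   cos t >= 1/2, where the difference of both sides is convex in a real variable n >= 2 and vanishes
   at n = 2 with nonnegative slope, and n (pi/2 - t) <= pi/2 with cos t < 1/2, where the residue of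
   n mod 4 determines the signs of sin nt and cos nt. *)
theory Submission
  imports Defs
begin

subsection \<open>The trigonometric inequality\<close>

lemma abs_sin_of_nat_mult_le:
  fixes x :: real
  shows "\<bar>sin (real n * x)\<bar> \<le> real n * \<bar>sin x\<bar>"
proof (induction n)
  case (Suc n)
  have "sin (real (Suc n) * x) = sin (real n * x) * cos x + cos (real n * x) * sin x"
    by (simp add: distrib_right sin_add add.commute)
  also have "\<bar>\<dots>\<bar> \<le> \<bar>sin (real n * x)\<bar> * 1 + 1 * \<bar>sin x\<bar>"
    by (rule order_trans[OF abs_triangle_ineq], unfold abs_mult)
       (intro add_mono mult_mono, auto)
  finally show ?case using Suc by (simp add: distrib_right)
qed simp

lemma jordan_sin_ge:
  fixes x :: real
  assumes "0 \<le> x" "x \<le> pi / 2"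
  shows "2 * x / pi \<le> sin x"
proof -
  have "concave_on {0..pi/2} (sin :: real \<Rightarrow> real)"
    by (rule f''_le0_imp_concave[where f' = cos and f'' = "\<lambda>x. - sin x"])
       (auto intro!: derivative_eq_intros sin_ge_zero)
  from concave_onD[OF this, of "2 * x / pi" 0 "pi/2"] assms show ?thesis
    by (simp add: field_simps)
qed

text \<open>The sinusoid \<open>K * sin t - M * cos t\<close> has amplitude sqrt(K^2 + M^2), and the
  first hypothesis says that K^2 + M^2 <= (M (1 + c))^2, since (1 + c)^2 - 1 = c (c + 2). It is
  applied at the angle n t with c = cos t, K = 1 + 2 cos t and M = n sin t.\<close>

lemma trig_amplitude_bound:
  fixes c K M t :: real
  assumes "K\<^sup>2 \<le> M\<^sup>2 * (c * (c + 2))" "0 \<le> c" "0 \<le> M"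
  shows "K * sin t \<le> M * (1 + c + cos t)"
proof -
  have "(K * sin t - M * cos t)\<^sup>2 \<le> (K * sin t - M * cos t)\<^sup>2 + (K * cos t + M * sin t)\<^sup>2"
    by simp
  also have "\<dots> = (K\<^sup>2 + M\<^sup>2) * ((sin t)\<^sup>2 + (cos t)\<^sup>2)"
    by algebra
  also have "\<dots> \<le> (M * (1 + c))\<^sup>2"
    using assms(1) by (simp add: power2_eq_square algebra_simps)
  finally have "K * sin t - M * cos t \<le> M * (1 + c)"
    by (rule power2_le_imp_le) (use assms in simp)
  then show ?thesis by (simp add: algebra_simps)
qed

text \<open>Right minus left side is the slope at v = 2 needed in \<open>trig_bound_near\<close>. It
  vanishes at t = 0 and is nondecreasing, because sin u <= u and 6 cos u <= 4 cos u + 2.\<close>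

lemma trig_bound_base:
  fixes t :: real
  assumes "0 \<le> t" "t \<le> pi / 2"
  shows "t * (2 * (cos t)\<^sup>2 + 2 * cos t - 1) \<le> (1 + 2 * cos t) * cos t * sin t"
proof -
  let ?k = "\<lambda>t::real. (1 + 2 * cos t) * cos t * sin t - t * (2 * (cos t)\<^sup>2 + 2 * cos t - 1)"
  have "?k 0 \<le> ?k t"
  proof (rule DERIV_nonneg_imp_nondecreasing[OF assms(1)])
    fix u :: real assume u: "0 \<le> u" "u \<le> t"
    have c: "0 \<le> cos u" "cos u \<le> 1" "0 \<le> sin u"
      using u assms by (auto intro!: cos_ge_zero sin_ge_zero)
    have su: "sin u \<le> u" using u sin_x_le_x by auto
    have s2: "sin u * sin u = 1 - cos u * cos u"
      using sin_squared_eq[of u] by (simp add: power2_eq_square)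
    have "(?k has_real_derivative sin u * ((4 * cos u + 2) * u - 6 * cos u * sin u)) (at u)"
      by (rule derivative_eq_intros refl | simp)+ (use s2 in algebra)
    moreover have "6 * cos u * sin u \<le> (4 * cos u + 2) * u"
      by (intro mult_mono) (use c su in auto)
    ultimately show "\<exists>y. DERIV ?k u :> y \<and> 0 \<le> y"
      using c by (intro exI conjI) (assumption, simp)
  qed
  then show ?thesis by simp
qed

text \<open>This is the convexity behind \<open>trig_bound_near\<close>: right minus left side,
  \<open>?w v\<close> below, is the second v-derivative of the gap there, divided by t^2. Up to v t
  = pi/2 it follows from \<open>?w 2\<close> being nonnegative and \<open>?w\<close> nondecreasing;
  beyond, from the signs of A, sine and cosine.\<close>

lemma trig_bound_concave:
  fixes t v :: real
  assumes t: "0 < t" "t \<le> pi / 2" and c: "1 / 2 \<le> cos t" and v: "2 \<le> v" "v * t \<le> pi"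
  shows "v * sin t * cos (v * t) \<le> (1 + 2 * cos t - 2 * sin t / t) * sin (v * t)"
proof -
  define A where "A = 1 + 2 * cos t - 2 * sin t / t"
  define s where "s = sin t"
  define c where "c = cos t"
  have s: "0 < s" "s \<le> t" using t unfolding s_def by (auto intro!: sin_gt_zero sin_x_le_x)
  have c12: "1 / 2 \<le> c" "c \<le> 1" using c by (auto simp: c_def)
  have At: "A * t = t * (1 + 2 * c) - 2 * s" using t by (simp add: A_def c_def s_def field_simps)
  have sc: "s * s = 1 - c * c"
    using sin_squared_eq[of t] by (simp add: power2_eq_square s_def c_def)
  \<comment> \<open>The bound on cos t enters: 1 + 2 cos t >= 2 >= 2 sin t / t.\<close>
  have A0: "0 \<le> A"
  proof -
    have "s / t \<le> 1" using s t by simp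
    then show ?thesis using c12 by (simp add: A_def s_def c_def)
  qed
  let ?w = "\<lambda>v. A * sin (v * t) - v * s * cos (v * t)"
  have "0 \<le> ?w v"
  proof (cases "v * t \<le> pi / 2")
    case False
    then have "cos (v * t) \<le> 0" "0 \<le> sin (v * t)"
      using v t cos_monotone_0_pi_le[of "pi / 2" "v * t"] by (auto intro!: sin_ge_zero)
    then show ?thesis using A0 s v
      by (smt (verit) mult_nonneg_nonneg mult_nonneg_nonpos)
  next
    case True
    have "0 \<le> ?w 2"
    proof -
      \<comment> \<open>\<open>?w 2\<close> equals 2 s (c A - cos 2t); multiplied by t, the bracket
        becomes (c + 1) t - 2 c s.\<close>
      have "2 * c * s \<le> (c + 1) * t"
        by (intro mult_mono) (use c12 s in auto)
      then have "t * (2 * c * c - 1) \<le> c * (A * t)"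
        unfolding At by (simp add: algebra_simps)
      then have "2 * c * c - 1 \<le> c * A"
        using t by (simp add: mult.left_commute mult.commute[of A])
      then have "2 * s * (2 * c * c - 1) \<le> 2 * s * (c * A)"
        using s by (intro mult_left_mono) auto
      then show ?thesis
        unfolding cos_double_cos sin_double s_def c_def
        by (simp add: algebra_simps power2_eq_square)
    qed
    also have "\<dots> \<le> ?w v"
    proof (rule DERIV_nonneg_imp_nondecreasing[OF v(1)])
      fix u assume u: "2 \<le> u" "u \<le> v"
      have ut: "2 * t \<le> u * t" "u * t \<le> pi / 2"
        using u t True by (auto intro: order_trans[rotated])
      have "2 * s * c \<le> sin (u * t)"
        using sin_monotone_2pi_le[of "2 * t" "u * t"] ut t
        by (simp add: sin_double s_def c_def)
      have cu: "0 \<le> cos (u * t)" "cos (u * t) \<le> 1"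
        using ut t pi_gt_zero by (intro cos_ge_zero cos_le_one; linarith)+
      \<comment> \<open>The derivative of \<open>?w\<close> is (A t - s) cos(u t) + u s t sin(u t).
        Its first term is at least -2 t (1 - c) cos(u t) because s <= t; its second is at least 2 s
        t sin 2t = 4 t (1 - c) (1 + c) c.\<close>
      have "t * (1 - c) * 2 * cos (u * t) \<le> t * (1 - c) * 2"
        using t c12 cu by (intro mult_left_le) auto
      also have "\<dots> \<le> t * (1 - c) * (4 * (1 + c) * c)"
      proof (intro mult_left_mono)
        have "1 * (1/2) \<le> (1 + c) * c" using c12 by (intro mult_mono) auto
        then show "2 \<le> 4 * (1 + c) * c" by (simp add: algebra_simps)
      qed (use t c12 in auto)
      also have "\<dots> = 2 * s * t * (2 * s * c)" 
        using sc by algebra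
      also have "\<dots> \<le> u * s * t * sin (u * t)"
        using \<open>2 * s * c \<le> _\<close> u s t c12 by (intro mult_mono) auto
      finally have 1: "t * (1 - c) * 2 * cos (u * t) \<le> u * s * t * sin (u * t)" .
      have "(3 * s - t * (1 + 2 * c)) * cos (u * t) \<le> t * (1 - c) * 2 * cos (u * t)"
        using s cu by (intro mult_right_mono) (auto simp: algebra_simps)
      with 1 have "0 \<le> (A * t - s) * cos (u * t) + u * s * t * sin (u * t)"
        unfolding At by (simp add: algebra_simps)
      moreover have "(?w has_real_derivative ((A * t - s) * cos (u * t) + u * s * t * sin (u * t))) (at u)"
        by (rule derivative_eq_intros refl | simp)+ (simp add: algebra_simps)
      ultimately show "\<exists>y. DERIV ?w u :> y \<and> 0 \<le> y" by blast
    qed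
    finally show ?thesis .
  qed
  then show ?thesis by (simp add: A_def s_def)
qed

text \<open>The gap is convex in v, hence lies above its tangent at v = 2, whose slope is controlled
  by \<open>trig_bound_base\<close>. The multiplier v is real so that one can differentiate in
  it.\<close>

lemma trig_bound_near:
  fixes t v :: real
  assumes t: "0 < t" "t \<le> pi / 2" and c: "1 / 2 \<le> cos t" and v: "2 \<le> v" "v * t \<le> pi"
  shows "(1 + 2 * cos t) * sin (v * t) \<le> v * sin t * (1 + cos t + cos (v * t))"
proof -
  let ?g = "\<lambda>v. v * sin t * (1 + cos t + cos (v * t)) - (1 + 2 * cos t) * sin (v * t)"
  let ?g' = "\<lambda>v. sin t * (1 + cos t + cos (v * t)) - v * t * sin t * sin (v * t)
                  - (1 + 2 * cos t) * t * cos (v * t)"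
  let ?g'' = "\<lambda>v. t\<^sup>2 * ((1 + 2 * cos t - 2 * sin t / t) * sin (v * t) - v * sin t * cos (v * t))"
  have "?g' 2 * (v - 2) \<le> ?g v - ?g 2"
  proof (rule f''_imp_f'[of "{2..v}" ?g ?g' ?g''])
    fix u assume u: "u \<in> {2..v}"
    show "(?g has_real_derivative ?g' u) (at u)"
      by (rule derivative_eq_intros refl | simp)+
    show "(?g' has_real_derivative ?g'' u) (at u)"
      by (rule derivative_eq_intros refl | simp)+
         (use t in \<open>simp add: field_simps power2_eq_square\<close>)
    have "u * t \<le> v * t" using u t by simp
    then show "0 \<le> ?g'' u"
      using trig_bound_concave[OF t c, of u] u v by simp
  qed (use v in auto)
  \<comment> \<open>v = 2 belongs to U_1 = 2x, which is its own tangent.\<close>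
  moreover have "?g 2 = 0"
    using cos_double_cos[of t] sin_double[of t] by algebra
  moreover have "0 \<le> ?g' 2"
  proof -
    have "?g' 2 = (1 + 2 * cos t) * cos t * sin t - t * (2 * (cos t)\<^sup>2 + 2 * cos t - 1)"
      using cos_double_cos[of t] sin_double[of t] sin_cos_squared_add[of t] by algebra
    then show ?thesis using trig_bound_base[of t] t by simp
  qed
  ultimately have "0 \<le> ?g v"
    using v by (smt (verit) mult_nonneg_nonneg)
  then show ?thesis by simp
qed

text \<open>With d = pi/2 - t, the angle n t is n pi/2 - n d with n d in [0, pi/2], so n mod 4 fixes
  its quadrant. Residues 0 and 3 give sin(n t) <= 0, residue 1 gives cos(n t) >= 0, and only residue
  2 needs a finer comparison.\<close>

lemma trig_bound_far:
  fixes t :: real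
  assumes t: "0 < t" "t \<le> pi / 2" and c: "cos t < 1 / 2" and n: "3 \<le> n"
    and nd: "real n * (pi / 2 - t) \<le> pi / 2"
  shows "(1 + 2 * cos t) * sin (real n * t) \<le> real n * sin t * (1 + cos t + cos (real n * t))"
proof -
  define d where "d = pi / 2 - t"
  define q where "q = n div 4"
  define r where "r = n mod 4"
  have n_eq: "n = 4 * q + r" "r < 4" by (auto simp: q_def r_def)
  have d: "0 \<le> d" "real n * d \<le> pi / 2" using t nd by (auto simp: d_def)
  have nd0: "0 \<le> real n * d" using d by simp
  have c0: "0 \<le> cos t" "cos t = sin d" "sin t = cos d"
    using t by (auto intro!: cos_ge_zero simp: d_def cos_diff sin_diff)
  \<comment> \<open>Since (sin t)^2 <= sin t, this yields sin t >= 3/4, enough for n sin t >= 2 when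
    n >= 3.\<close>
  have "(3/4) \<le> (sin t)\<^sup>2"
  proof -
    have "cos t * cos t \<le> 1/2 * (1/2)" using c c0 by (intro mult_mono) auto
    then show ?thesis using sin_squared_eq[of t] by (simp add: power2_eq_square)
  qed
  moreover have s0: "0 < sin t" "sin t \<le> 1" using t by (auto intro!: sin_gt_zero)
  moreover have "(sin t)\<^sup>2 \<le> sin t * 1"
    unfolding power2_eq_square using s0 by (intro mult_left_mono) auto
  ultimately have s: "3 / 4 \<le> sin t" by simp
  have arg: "real n * t = real r * (pi / 2) - real n * d + 2 * real q * pi"
  proof -
    have "real n * t = real n * (pi / 2) - real n * d" by (simp add: d_def algebra_simps)
    also have "real n * (pi / 2) = real r * (pi / 2) + 2 * real q * pi"
      by (subst n_eq(1)) (simp add: algebra_simps)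
    finally show ?thesis by simp
  qed
  have sin_n: "sin (real n * t) = sin (real r * (pi / 2) - real n * d)"
    and cos_n: "cos (real n * t) = cos (real r * (pi / 2) - real n * d)"
    unfolding arg sin_add cos_add sin_2npi cos_2npi by simp_all
  have S: "0 \<le> sin (real n * d)" "0 \<le> cos (real n * d)"
    using nd0 d pi_gt_zero by (intro sin_ge_zero cos_ge_zero; linarith)+
  have neg: ?thesis if "sin (real n * t) \<le> 0"
  proof -
    have "(1 + 2 * cos t) * sin (real n * t) \<le> 0"
      using that c0 by (simp add: mult_nonneg_nonpos)
    also have "0 \<le> 1 + cos t + cos (real n * t)"
      using c0(1) cos_ge_minus_one[of "real n * t"] by linarith
    then have "0 \<le> real n * sin t * (1 + cos t + cos (real n * t))"
      using s0 by simp
    finally show ?thesis .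
  qed
  consider "r = 0" | "r = 1" | "r = 2" | "r = 3" using n_eq(2) by linarith
  then show ?thesis
  proof cases
    case 1
    then show ?thesis using S sin_n by (intro neg) simp
  next
    case 2
    have "(1 + 2 * cos t) * sin (real n * t) \<le> (1 + 2 * cos t) * 1"
      using c0(1) by (intro mult_left_mono) auto
    also have "\<dots> \<le> 2 * (1 + cos t)" by simp
    also have "\<dots> \<le> (real n * sin t) * (1 + cos t + cos (real n * t))"
    proof (intro mult_mono)
      have "3 * (3 / 4) \<le> real n * sin t" using n s by (intro mult_mono) auto
      then show "2 \<le> real n * sin t" by simp
      show "1 + cos t \<le> 1 + cos t + cos (real n * t)" using 2 S cos_n by (simp add: cos_diff)
    qed (use c0 s0 in auto)
    finally show ?thesis .
  next
    case 3
    define m where "m = 2 * q + 1"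
    have m: "n = 2 * m" "1 \<le> m" using n_eq 3 by (auto simp: m_def)
    \<comment> \<open>Modulo 2 pi the angle is pi - 2 m d, and sin(m (2 d)) <= m sin 2d = n sin t
      cos t.\<close>
    have "sin (real n * t) = sin (real m * (2 * d))"
      using sin_n 3 m by (simp add: sin_diff mult.left_commute mult.assoc)
    also have "\<dots> \<le> real m * \<bar>sin (2 * d)\<bar>"
      using abs_sin_of_nat_mult_le[of m "2 * d"] by linarith
    also have "\<dots> = real n * sin t * cos t"
      using c0 s0 m by (simp add: sin_double)
    finally have "(1 + 2 * cos t) * sin (real n * t) \<le> (1 + 2 * cos t) * (real n * sin t * cos t)"
      using c0(1) by (intro mult_left_mono) auto
    also have "\<dots> = real n * sin t * (cos t + 2 * (cos t)\<^sup>2)"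
      by (simp add: algebra_simps power2_eq_square)
    also have "\<dots> \<le> real n * sin t * (1 + cos t + cos (real n * t))"
    proof (intro mult_left_mono)
      \<comment> \<open>As cos(n t) = 2 sin^2(m d) - 1, what remains is sin(m d) >= sin d = cos
        t.\<close>
      have "d \<le> real m * d" using m(2) d(1) by (simp add: mult_le_cancel_right1)
      moreover have "real m * d \<le> pi / 2" using d(2) nd0 unfolding m of_nat_mult by linarith
      ultimately have "sin d \<le> sin (real m * d)"
        using d(1) by (intro sin_monotone_2pi_le) auto
      then have "(cos t)\<^sup>2 \<le> (sin (real m * d))\<^sup>2"
        using c0 by (intro power_mono) auto
      moreover have "cos (real n * t) = - cos (2 * (real m * d))"
        using cos_n 3 m by (simp add: cos_diff mult.assoc)
      ultimately show "cos t + 2 * (cos t)\<^sup>2 \<le> 1 + cos t + cos (real n * t)"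
        by (simp add: cos_double_sin)
    qed (use s0 in auto)
    finally show ?thesis .
  next
    case 4
    have "cos (3 * pi / 2) = 0" "sin (3 * pi / 2) = -1"
      using cos_3over2_pi sin_3over2_pi by (simp_all add: mult.commute)
    then show ?thesis using 4 S sin_n by (intro neg) (simp add: sin_diff)
  qed
qed

text \<open>For n = 1 and n = 2 both sides agree, U_0 and U_1 being affine. For n >= 3, outside the
  ranges of \<open>trig_bound_near\<close> and \<open>trig_bound_far\<close>, the chord bound for
  sine makes n sin t or n cos t large enough for the amplitude bound.\<close>

lemma trig_bound:
  fixes t :: real
  assumes t: "0 < t" "t \<le> pi / 2" and n: "1 \<le> n"
  shows "(1 + 2 * cos t) * sin (real n * t) \<le> real n * sin t * (1 + cos t + cos (real n * t))"
proof -
  have c0: "0 \<le> cos t" "cos t \<le> 1" using t by (auto intro!: cos_ge_zero)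
  have s0: "0 < sin t" "sin t \<le> 1" using t by (auto intro!: sin_gt_zero)
  have amp: ?thesis if "(1 + 2 * cos t)\<^sup>2 \<le> (real n * sin t)\<^sup>2 * (cos t * (cos t + 2))"
    by (rule trig_amplitude_bound[OF that]) (use c0 s0 in auto)
  consider "n = 1" | "n = 2" | "3 \<le> n" using n by linarith
  then show ?thesis
  proof cases
    case 1
    then show ?thesis by (simp add: algebra_simps)
  next
    case 2
    then have double: "cos (real n * t) = 2 * (cos t)\<^sup>2 - 1" "sin (real n * t) = 2 * sin t * cos t"
      by (simp_all add: cos_double_cos sin_double)
    show ?thesis unfolding double using 2 by (simp add: algebra_simps power2_eq_square)
  next
    case n3: 3
    show ?thesis
    proof (cases "1 / 2 \<le> cos t")
      case c: True
      show ?thesis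
      proof (cases "real n * t \<le> pi")
        case True
        then show ?thesis using trig_bound_near[of t "real n"] t c n3 by simp
      next
        case False
        \<comment> \<open>Once n sin t >= 2, the amplitude condition reduces to (1 + 2c)^2 <= 4 c (c
          + 2), that is, c >= 1/4.\<close>
        have "2 \<le> real n * (2 * t / pi)" using False by (simp add: field_simps)
        also have "\<dots> \<le> real n * sin t"
          using jordan_sin_ge[of t] t by (intro mult_left_mono) auto
        finally have "2\<^sup>2 \<le> (real n * sin t)\<^sup>2"
          by (intro power_mono) auto
        then have "2\<^sup>2 * (cos t * (cos t + 2)) \<le> (real n * sin t)\<^sup>2 * (cos t * (cos t + 2))"
          using c0 by (intro mult_right_mono) auto
        moreover have "(1 + 2 * cos t)\<^sup>2 \<le> 2\<^sup>2 * (cos t * (cos t + 2))"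
          using c by (simp add: power2_eq_square algebra_simps)
        ultimately show ?thesis by (intro amp) linarith
      qed
    next
      case c: False
      show ?thesis
      proof (cases "real n * (pi / 2 - t) \<le> pi / 2")
        case True
        then show ?thesis using trig_bound_far[of t n] t c n3 by simp
      next
        case False
        have "1 \<le> real n * (2 * (pi / 2 - t) / pi)" using False by (simp add: field_simps)
        also have "\<dots> \<le> real n * cos t"
          using jordan_sin_ge[of "pi / 2 - t"] t by (intro mult_left_mono) (auto simp: sin_diff)
        finally have nc: "1 \<le> real n * cos t" .
        have cc: "cos t * cos t \<le> 1/2 * (1/2)" using c c0 by (intro mult_mono) auto
        then have s: "3 / 4 \<le> (sin t)\<^sup>2" using sin_squared_eq[of t] by (simp add: power2_eq_square)
        have "(1 + 2 * cos t)\<^sup>2 \<le> 2\<^sup>2" using c c0 by (intro power_mono) auto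
        \<comment> \<open>The factors are the lower bounds for n, n cos t, (sin t)^2 and cos t +
          2.\<close>
        also have "\<dots> \<le> (3 * 1) * (3 / 4 * 2)" by simp
        also have "\<dots> \<le> (real n * (real n * cos t)) * ((sin t)\<^sup>2 * (cos t + 2))"
          using n3 nc s c0 by (intro mult_mono) auto
        also have "\<dots> = (real n * sin t)\<^sup>2 * (cos t * (cos t + 2))"
          by (simp add: power2_eq_square algebra_simps)
        finally show ?thesis by (rule amp)
      qed
    qed
  qed
qed

subsection \<open>Chebyshev polynomials of the second kind\<close>

text \<open>Shifted by one: \<open>chebU (n + 1)\<close> is the usual \<open>U\<^sub>n\<close>.\<close>

fun chebU :: "nat \<Rightarrow> real poly" where
  "chebU 0 = 0"
| "chebU (Suc 0) = 1"
| "chebU (Suc (Suc n)) = [:0, 2:] * chebU (Suc n) - chebU n"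

lemma chebU_cos: "poly (chebU n) (cos t) * sin t = sin (real n * t)"
proof (induction n rule: chebU.induct)
  case (3 n)
  have "sin (real (Suc (Suc n)) * t) = 2 * cos t * sin (real (Suc n) * t) - sin (real n * t)"
  proof -
    have "2 * (cos t * sin (real (Suc n) * t)) = sin (t + real (Suc n) * t) - sin (t - real (Suc n) * t)"
      by (simp add: cos_times_sin)
    also have "t + real (Suc n) * t = real (Suc (Suc n)) * t" by (simp add: algebra_simps)
    also have "t - real (Suc n) * t = - (real n * t)" by (simp add: algebra_simps)
    finally show ?thesis by simp
  qed
  then show ?case using 3 by (simp add: algebra_simps)
qed simp_all

lemma chebU_one: "poly (chebU n) 1 = real n"
  by (induction n rule: chebU.induct) auto

text \<open>Both sides of \<open>chebU_cos\<close> are differentiated in t. Keeping the factor (sin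
  t)^2 avoids a division where sin t = 0.\<close>

lemma pderiv_chebU_cos:
  "(sin t)\<^sup>2 * poly (pderiv (chebU n)) (cos t) = cos t * poly (chebU n) (cos t) - real n * cos (real n * t)"
proof -
  have "((\<lambda>t. poly (chebU n) (cos t) * sin t) has_real_derivative
          poly (pderiv (chebU n)) (cos t) * (- sin t) * sin t + cos t * poly (chebU n) (cos t)) (at t)"
    by (rule derivative_eq_intros DERIV_chain2[OF poly_DERIV] refl | simp)+
  moreover have "((\<lambda>t. sin (real n * t)) has_real_derivative real n * cos (real n * t)) (at t)"
    by (rule derivative_eq_intros refl | simp)+
  ultimately have "poly (pderiv (chebU n)) (cos t) * (- sin t) * sin t + cos t * poly (chebU n) (cos t)
      = real n * cos (real n * t)"
    unfolding chebU_cos by (rule DERIV_unique)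
  then show ?thesis by (simp add: power2_eq_square algebra_simps)
qed

text \<open>Multiplying the gap at x = cos t by (1 + cos t) sin t turns (1 - x) into (sin t)^2, so
  \<open>pderiv_chebU_cos\<close> eliminates the derivative and \<open>trig_bound\<close> remains.
  At x = 1 this multiplier vanishes, so that case is separate.\<close>

lemma chebU_tangent:
  assumes "0 \<le> x" "x \<le> 1"
  shows "(1 - x) * poly (pderiv (chebU n)) x \<le> poly (chebU n) 1 - poly (chebU n) x"
proof (cases "x = 1 \<or> n = 0")
  case False
  define t where "t = arccos x"
  have x: "x = cos t" using assms by (simp add: t_def)
  have t: "0 < t" "t \<le> pi / 2"
    using assms False arccos_lt_bounded[of x] arccos_le_pi2[of x] by (auto simp: t_def)
  have c0: "0 \<le> cos t" and s0: "0 < sin t"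
    using t by (auto intro!: cos_ge_zero sin_gt_zero)
  let ?U = "poly (chebU n) (cos t)" and ?D = "poly (pderiv (chebU n)) (cos t)"
  have s2: "(sin t)\<^sup>2 = (1 - cos t) * (1 + cos t)"
    using sin_squared_eq[of t] by algebra
  have "(1 + cos t) * sin t * (real n - ?U - (1 - cos t) * ?D)
      = (1 + cos t) * sin t * real n - (1 + cos t) * (?U * sin t) - sin t * ((sin t)\<^sup>2 * ?D)"
    unfolding s2 by algebra
  also have "\<dots> = real n * sin t * (1 + cos t + cos (real n * t)) - (1 + 2 * cos t) * (?U * sin t)"
    unfolding pderiv_chebU_cos by algebra
  also have "\<dots> \<ge> 0"
    unfolding chebU_cos using trig_bound[OF t, of n] False by simp
  finally have "(1 + cos t) * sin t * 0 \<le> (1 + cos t) * sin t * (real n - ?U - (1 - cos t) * ?D)"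
    by simp
  moreover have "0 < (1 + cos t) * sin t" using c0 s0 by simp
  ultimately have "0 \<le> real n - ?U - (1 - cos t) * ?D"
    by (simp only: mult_le_cancel_left_pos)
  then show ?thesis by (simp add: x chebU_one)
qed (auto)

subsection \<open>The cosine expansion of ultraspherical polynomials\<close>

text \<open>The coefficient of z^k in (1 - z)^(-l).\<close>

definition rising_coeff :: "real \<Rightarrow> nat \<Rightarrow> real" where
  "rising_coeff l k = pochhammer l k / fact k"

lemma rising_coeff_0 [simp]: "rising_coeff l 0 = 1"
  by (simp add: rising_coeff_def)

lemma rising_coeff_Suc: "real (Suc k) * rising_coeff l (Suc k) = (l + real k) * rising_coeff l k"
  by (simp add: rising_coeff_def pochhammer_Suc field_simps del: of_nat_Suc)

lemma rising_coeff_nonneg: "0 < l \<Longrightarrow> 0 \<le> rising_coeff l k"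
  by (simp add: rising_coeff_def pochhammer_nonneg)

text \<open>For \<open>l \<ge> 1\<close> the ratios \<open>(l + k) / (k + 1)\<close> of consecutive coefficients decrease in \<open>k\<close>.\<close>

lemma rising_coeff_log_concave:
  assumes "1 \<le> l" "i \<le> j"
  shows "rising_coeff l i * rising_coeff l (Suc j) \<le> rising_coeff l (Suc i) * rising_coeff l j"
proof -
  let ?a = "rising_coeff l"
  have Suc_eq: "?a (Suc k) = (l + real k) / real (Suc k) * ?a k" for k
    using rising_coeff_Suc[of k l] by (simp add: field_simps del: of_nat_Suc)
  \<comment> \<open>The difference of the two sides is (l - 1) (j - i).\<close>
  have "(l + real j) * (real i + 1) \<le> (l + real i) * (real j + 1)"
    using mult_mono[of 1 l "real i" "real j"] mult_right_mono[of 1 l "real j - real i"] assms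
    by (simp add: algebra_simps)
  then have "(l + real j) / real (Suc j) \<le> (l + real i) / real (Suc i)"
    by (simp add: field_simps)
  then have "(l + real j) / real (Suc j) * (?a i * ?a j) \<le> (l + real i) / real (Suc i) * (?a i * ?a j)"
    using assms rising_coeff_nonneg[of l] by (intro mult_right_mono) auto
  then show ?thesis unfolding Suc_eq by (simp add: mult_ac)
qed

text \<open>Comparison of coefficients in the differential equation of (1 - c z + z^2)^(-l). The
  field is arbitrary because the result serves both a real and a complex series.\<close>

lemma gegenbauer_ode_recurrence:
  fixes f :: "'a :: field fps"
  assumes "(1 - fps_const c * fps_X + fps_X ^ 2) * fps_deriv f = fps_const l * (fps_const c - 2 * fps_X) * f"
  shows "fps_nth f 1 = l * c * fps_nth f 0"
    and "of_nat (n + 2) * fps_nth f (n + 2) =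
           c * (of_nat (n + 1) + l) * fps_nth f (n + 1) - (of_nat n + 2 * l) * fps_nth f n"
proof -
  have 1: "(1 - fps_const c * fps_X + fps_X ^ 2) * fps_deriv f =
      fps_deriv f - fps_const c * (fps_X * fps_deriv f) + fps_X * (fps_X * fps_deriv f)"
    by (simp add: algebra_simps power2_eq_square)
  have 2: "fps_const l * (fps_const c - 2 * fps_X) * f =
      fps_const (l * c) * f - fps_const (2 * l) * (fps_X * f)"
    by (simp add: algebra_simps numeral_fps_const flip: fps_const_mult)
  note eq = assms[unfolded 1 2]
  from arg_cong[OF eq, of "\<lambda>g. fps_nth g 0"] show "fps_nth f 1 = l * c * fps_nth f 0"
    by simp
  from arg_cong[OF eq, of "\<lambda>g. fps_nth g (Suc n)"]
  show "of_nat (n + 2) * fps_nth f (n + 2) =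
           c * (of_nat (n + 1) + l) * fps_nth f (n + 1) - (of_nat n + 2 * l) * fps_nth f n"
    by (cases n) (simp_all add: algebra_simps)
qed

text \<open>The binomial series B satisfies (1 + z) B' = -l B; substituting u = z^2 - 2 x z and
  applying the chain rule gives the equation.\<close>

lemma ultraspherical_ode:
  fixes l x :: real
  defines "F \<equiv> Abs_fps (\<lambda>n. poly (ultraspherical l n) x)"
  shows "(1 - fps_const (2 * x) * fps_X + fps_X ^ 2) * fps_deriv F =
           fps_const l * (fps_const (2 * x) - 2 * fps_X) * F"
proof -
  define u :: "real fps" where "u = fps_X ^ 2 - fps_const (2 * x) * fps_X"
  have u0: "fps_nth u 0 = 0" by (simp add: u_def)
  let ?B = "fps_binomial (- l)"
  have F: "F = ?B oo u" unfolding F_def u_def by (rule ultraspherical_gf_at)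
  have "(1 + fps_X) * fps_deriv ?B = fps_const (- l) * ?B"
    unfolding fps_binomial_deriv by (simp add: fps_divide_unit mult.commute mult.left_commute inverse_mult_eq_1')
  then have "((1 + fps_X) * fps_deriv ?B) oo u = (fps_const (- l) * ?B) oo u"
    by simp
  then have "(1 + u) * (fps_deriv ?B oo u) = fps_const (- l) * F"
    unfolding F by (simp add: fps_compose_mult_distrib[OF u0] fps_compose_add_distrib u0)
  then have "(1 + u) * fps_deriv F = fps_const (- l) * F * fps_deriv u"
    unfolding F fps_compose_deriv[OF u0] by (simp add: mult.assoc[symmetric])
  also have "fps_deriv u = 2 * fps_X - fps_const (2 * x)"
    by (simp add: u_def fps_deriv_power numeral_fps_const)
  finally show ?thesis
    by (simp add: u_def algebra_simps flip: fps_const_neg)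
qed

text \<open>Since 1 - 2 z cos t + z^2 = (1 - e^(it) z) (1 - e^(-it) z), the generating function
  should be the product of the series \<open>A t\<close> and \<open>A (- t)\<close> of (1 - e^(it)
  z)^(-l) and (1 - e^(-it) z)^(-l). This is proved by uniqueness: both satisfy the same differential
  equation with constant term 1.\<close>

lemma ultraspherical_cos:
  "poly (ultraspherical l n) (cos t) =
     (\<Sum>i\<le>n. rising_coeff l i * rising_coeff l (n - i) * cos ((real n - 2 * real i) * t))"
proof -
  define A where "A s = Abs_fps (\<lambda>k. complex_of_real (rising_coeff l k) * cis s ^ k)" for s
  define F where "F = Abs_fps (\<lambda>n. poly (ultraspherical l n) (cos t))"
  define G where "G = A t * A (- t)"
  have A_ode: "(1 - fps_const (cis s) * fps_X) * fps_deriv (A s) = fps_const (of_real l * cis s) * A s" for s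
  proof (rule fps_ext)
    fix k
    have "complex_of_real (real (Suc k) * rising_coeff l (Suc k)) = of_real ((l + real k) * rising_coeff l k)"
      by (simp only: rising_coeff_Suc)
    then have "(1 + of_nat k) * complex_of_real (rising_coeff l (Suc k)) = (of_real l + of_nat k) * of_real (rising_coeff l k)"
      by simp
    then show "fps_nth ((1 - fps_const (cis s) * fps_X) * fps_deriv (A s)) k =
               fps_nth (fps_const (of_real l * cis s) * A s) k"
      by (cases k) (simp_all add: A_def algebra_simps)
  qed
  have cis_mult_neg: "fps_const (cis t) * fps_const (cis (- t)) = 1"
    by (simp add: cis_mult)
  have cis_add_neg: "fps_const (of_real (2 * cos t)) = fps_const (cis t) + fps_const (cis (- t))"
    by (simp add: complex_eq_iff)
  have "(1 - fps_const (of_real (2 * cos t)) * fps_X + fps_X ^ 2) * fps_deriv G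
      = ((1 - fps_const (cis t) * fps_X) * fps_deriv (A t)) * A (- t) * (1 - fps_const (cis (- t)) * fps_X)
      + ((1 - fps_const (cis (- t)) * fps_X) * fps_deriv (A (- t))) * A t * (1 - fps_const (cis t) * fps_X)"
    unfolding G_def fps_deriv_mult cis_add_neg using cis_mult_neg by algebra
  also have "\<dots> = fps_const (of_real l) * (fps_const (of_real (2 * cos t)) - 2 * fps_X) * G"
    unfolding A_ode cis_add_neg G_def fps_const_mult[symmetric] using cis_mult_neg by algebra
  finally have G_ode: "(1 - fps_const (of_real (2 * cos t)) * fps_X + fps_X ^ 2) * fps_deriv G
      = fps_const (of_real l) * (fps_const (of_real (2 * cos t)) - 2 * fps_X) * G" .
  note rec_G = gegenbauer_ode_recurrence[OF G_ode]
  note rec_F = gegenbauer_ode_recurrence[OF ultraspherical_ode[where l = l and x = "cos t"], folded F_def]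
  have F0: "fps_nth F 0 = 1" unfolding F_def ultraspherical_gf_at by simp
  have G0: "fps_nth G 0 = 1" by (simp add: G_def A_def)
  \<comment> \<open>The recurrence has order two, so the induction carries two consecutive
    coefficients.\<close>
  have "complex_of_real (fps_nth F n) = fps_nth G n \<and>
        complex_of_real (fps_nth F (Suc n)) = fps_nth G (Suc n)"
  proof (induction n)
    case 0
    then show ?case using rec_F(1) rec_G(1) F0 G0 by simp
  next
    case (Suc n)
    have "of_nat (n + 2) * complex_of_real (fps_nth F (n + 2)) = of_real (of_nat (n + 2) * fps_nth F (n + 2))"
      by simp
    also have "\<dots> = of_nat (n + 2) * fps_nth G (n + 2)"
      unfolding rec_F(2) rec_G(2) using Suc by simp
    finally have "of_nat (n + 2) * complex_of_real (fps_nth F (n + 2)) = of_nat (n + 2) * fps_nth G (n + 2)" .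
    moreover have "of_nat (n + 2) \<noteq> (0 :: complex)" unfolding of_nat_eq_0_iff by simp
    ultimately have "complex_of_real (fps_nth F (n + 2)) = fps_nth G (n + 2)"
      using mult_left_cancel by blast
    then show ?case using Suc by simp
  qed
  then have "poly (ultraspherical l n) (cos t) = Re (fps_nth G n)"
    by (metis F_def Re_complex_of_real fps_nth_Abs_fps)
  also have "fps_nth G n = (\<Sum>i\<le>n. of_real (rising_coeff l i * rising_coeff l (n - i)) *
      cis (- ((real n - 2 * real i) * t)))"
    unfolding G_def fps_mult_nth atLeast0AtMost
  proof (rule sum.cong)
    fix i assume "i \<in> {..n}"
    then have "cis t ^ i * cis (- t) ^ (n - i) = cis (- ((real n - 2 * real i) * t))"
      by (simp add: Complex.DeMoivre cis_mult algebra_simps of_nat_diff)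
    then show "fps_nth (A t) i * fps_nth (A (- t)) (n - i) =
        of_real (rising_coeff l i * rising_coeff l (n - i)) * cis (- ((real n - 2 * real i) * t))"
      by (simp add: A_def mult_ac)
  qed simp
  finally show ?thesis by (simp add: Re_sum)
qed

subsection \<open>Positive expansion in Chebyshev polynomials\<close>

text \<open>The increment b_k - b_(k-1) of b_k = a_k a_(n-k), with b_(-1) = b_(n+1) = 0. The
  conditionals enforce these zeros against truncated subtraction.\<close>

definition conn_coeff :: "real \<Rightarrow> nat \<Rightarrow> nat \<Rightarrow> real" where
  "conn_coeff l n k =
     (if k \<le> n then rising_coeff l k * rising_coeff l (n - k) else 0) -
     (if k = 0 then 0 else rising_coeff l (k - 1) * rising_coeff l (n - (k - 1)))"

text \<open>Summation by parts, from 2 cos(m t) sin t = sin((m + 1) t) - sin((m - 1) t) with m = n -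
  2k.\<close>

lemma conn_coeff_sum:
  "(\<Sum>k\<le>Suc n. conn_coeff l n k * sin ((real n + 1 - 2 * real k) * t)) =
     2 * (poly (ultraspherical l n) (cos t) * sin t)"
proof -
  let ?b = "\<lambda>k. rising_coeff l k * rising_coeff l (n - k)"
  have "(\<Sum>k\<le>Suc n. conn_coeff l n k * sin ((real n + 1 - 2 * real k) * t))
      = (\<Sum>k\<le>Suc n. (if k \<le> n then ?b k else 0) * sin ((real n + 1 - 2 * real k) * t))
      - (\<Sum>k\<le>Suc n. (if k = 0 then 0 else ?b (k - 1)) * sin ((real n + 1 - 2 * real k) * t))"
    by (simp only: conn_coeff_def left_diff_distrib sum_subtractf)
  also have "(\<Sum>k\<le>Suc n. (if k \<le> n then ?b k else 0) * sin ((real n + 1 - 2 * real k) * t))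
      = (\<Sum>k\<le>n. ?b k * sin ((real n + 1 - 2 * real k) * t))"
    by simp
  also have "(\<Sum>k\<le>Suc n. (if k = 0 then 0 else ?b (k - 1)) * sin ((real n + 1 - 2 * real k) * t))
      = (\<Sum>k\<le>n. ?b k * sin ((real n - 1 - 2 * real k) * t))"
    by (subst sum.atMost_Suc_shift) (simp add: algebra_simps)
  also have "(\<Sum>k\<le>n. ?b k * sin ((real n + 1 - 2 * real k) * t)) - \<dots>
      = (\<Sum>k\<le>n. ?b k * (2 * (cos ((real n - 2 * real k) * t) * sin t)))"
    unfolding sum_subtractf[symmetric]
  proof (intro sum.cong refl)
    fix k
    have "(real n + 1 - 2 * real k) * t = (real n - 2 * real k) * t + t"
      "(real n - 1 - 2 * real k) * t = (real n - 2 * real k) * t - t"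
      by (simp_all add: algebra_simps)
    then show "?b k * sin ((real n + 1 - 2 * real k) * t) - ?b k * sin ((real n - 1 - 2 * real k) * t)
        = ?b k * (2 * (cos ((real n - 2 * real k) * t) * sin t))"
      by (simp add: cos_times_sin right_diff_distrib)
  qed
  also have "\<dots> = 2 * (poly (ultraspherical l n) (cos t) * sin t)"
    unfolding ultraspherical_cos by (simp add: sum_distrib_left sum_distrib_right mult_ac)
  finally show ?thesis .
qed

text \<open>Log-concavity makes b_k increase up to the middle and decrease after it; the second half
  uses the same inequality with the two indices exchanged.\<close>

lemma conn_coeff_sign:
  assumes "1 \<le> l" "k \<le> Suc n"
  shows "2 * k \<le> Suc n \<Longrightarrow> 0 \<le> conn_coeff l n k"
    and "Suc n \<le> 2 * k \<Longrightarrow> conn_coeff l n k \<le> 0"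
proof -
  have nonneg: "0 \<le> rising_coeff l i" for i
    using assms rising_coeff_nonneg[of l] by simp
  show "0 \<le> conn_coeff l n k" if "2 * k \<le> Suc n"
  proof (cases k)
    case (Suc i)
    with that rising_coeff_log_concave[of l i "n - Suc i"] assms(1) show ?thesis
      by (simp add: conn_coeff_def Suc_diff_Suc)
  qed (use nonneg in \<open>simp add: conn_coeff_def\<close>)
  show "conn_coeff l n k \<le> 0" if "Suc n \<le> 2 * k"
  proof (cases k)
    case (Suc i)
    show ?thesis
    proof (cases "k \<le> n")
      case True
      with that Suc rising_coeff_log_concave[of l "n - Suc i" i] assms(1) show ?thesis
        by (simp add: conn_coeff_def Suc_diff_Suc mult.commute)
    qed (use nonneg Suc in \<open>simp add: conn_coeff_def\<close>)
  qed (use that in simp)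
qed

text \<open>Past the middle, n + 1 - 2k and the increment are both nonpositive, and oddness of sine
  cancels the two signs; hence the absolute values. The terms k and n + 1 - k coincide, which
  explains the factor 2.\<close>

lemma ultraspherical_chebU:
  assumes "1 \<le> l"
  shows "smult 2 (ultraspherical l n) =
    (\<Sum>k\<le>Suc n. smult \<bar>conn_coeff l n k\<bar> (chebU (nat \<bar>int (Suc n) - 2 * int k\<bar>)))"
    (is "?p = ?q")
proof -
  have "poly ?p x = poly ?q x" if "x \<in> {-1<..<1}" for x
  proof -
    define t where "t = arccos x"
    have x: "x = cos t" using that by (simp add: t_def)
    have s: "0 < sin t"
      using that arccos_lt_bounded[of x] by (intro sin_gt_zero) (auto simp: t_def)
    have "\<bar>conn_coeff l n k\<bar> * sin (real (nat \<bar>int (Suc n) - 2 * int k\<bar>) * t) =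
          conn_coeff l n k * sin ((real n + 1 - 2 * real k) * t)" if "k \<le> Suc n" for k
    proof (cases "2 * k \<le> Suc n")
      case True
      then have "real (nat \<bar>int (Suc n) - 2 * int k\<bar>) = real n + 1 - 2 * real k" by linarith
      then show ?thesis unfolding abs_of_nonneg[OF conn_coeff_sign(1)[OF assms that True]] by (simp only:)
    next
      case False
      then have "real (nat \<bar>int (Suc n) - 2 * int k\<bar>) = - (real n + 1 - 2 * real k)" by linarith
      then have "sin (real (nat \<bar>int (Suc n) - 2 * int k\<bar>) * t) = - sin ((real n + 1 - 2 * real k) * t)"
        by (simp only: mult_minus_left sin_minus)
      then show ?thesis using conn_coeff_sign(2)[OF assms that] False by simp
    qed
    then have "poly ?q x * sin t = (\<Sum>k\<le>Suc n. conn_coeff l n k * sin ((real n + 1 - 2 * real k) * t))"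
      unfolding x poly_sum poly_smult sum_distrib_right mult.assoc chebU_cos
      by (intro sum.cong) auto
    then show ?thesis
      using s unfolding conn_coeff_sum by (simp add: x)
  qed
  \<comment> \<open>Dividing by sin t gives equality only inside (-1, 1), but infinitely many zeros
    force the difference to vanish.\<close>
  then have "{-1<..<1} \<subseteq> {x. poly (?p - ?q) x = 0}" by auto
  then have "infinite {x. poly (?p - ?q) x = 0}"
    by (rule infinite_super) simp
  then show ?thesis using poly_roots_finite[of "?p - ?q"] by force
qed

section \<open>The tangent inequality for ultraspherical polynomials\<close>

theorem corollary1p4:
  fixes lam x :: real and n :: nat
  assumes "lam \<ge> 1" and "x \<in> {0..1}"
  shows "poly (ultraspherical lam n) 1 - poly (ultraspherical lam n) x
           \<ge> (1 - x) * deriv (\<lambda>u. poly (ultraspherical lam n) u) x"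
proof -
  \<comment> \<open>A linear functional of p, nonnegative on every \<open>chebU\<close> and
    therefore on their nonnegative combinations.\<close>
  define gap where "gap p = poly p 1 - poly p x - (1 - x) * poly (pderiv p) x" for p
  have gap_smult: "gap (smult a p) = a * gap p" for a p
    by (simp add: gap_def pderiv_smult algebra_simps)
  have gap_sum: "gap (\<Sum>k\<in>A. f k) = (\<Sum>k\<in>A. gap (f k))" for f :: "nat \<Rightarrow> real poly" and A
    by (induction A rule: infinite_finite_induct) (simp_all add: gap_def pderiv_add algebra_simps)
  have "0 \<le> gap (smult 2 (ultraspherical lam n))"
    unfolding ultraspherical_chebU[OF assms(1)] gap_sum gap_smult
    using chebU_tangent[of x] assms(2)
    by (intro sum_nonneg mult_nonneg_nonneg) (auto simp: gap_def)
  moreover have "deriv (\<lambda>u. poly (ultraspherical lam n) u) x = poly (pderiv (ultraspherical lam n)) x"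
    by (rule DERIV_imp_deriv) (rule poly_DERIV)
  ultimately show ?thesis unfolding gap_smult by (simp add: gap_def)
qed

end
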